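(* Let $S=\{n_1,n_2,\ldots,n_s\}$ be a set of integers with $2\le n_s<\cdots<n_2<n_1$, and suppose $n_1-1\notin S$ and $n_s+1\in S$ (so $n_{s-1}=n_s+1$ and $s\ge3$). Let $T=(m_1,\ldots,m_{s-1})=(n_1,\ldots,n_{s-2},n_s)$ and let $\mathcal H^{\star1}_{n_1,\ldots,n_s}$ be the mixed hypergraph obtained from $\mathcal H^{\star}_{T}=(X_T,\mathcal C^{\star}_T,\mathcal D_T)$ by deleting the $\mathcal C$-edge $e_2=\{(n_s,\ldots,n_s,1),(n_s,\ldots,n_s,n_s),(1,\ldots,1,1)\}$ (these are $(s-1)$-tuples; in the first, $n_s$ is repeated $s-2$ times). Then $\mathcal H^{\star1}_{n_1,\ldots,n_s}$ is a one-realization of $S$.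
   Context: A mixed hypergraph is a triple $\mathcal H=(X,\mathcal C,\mathcal D)$ where $X$ is a finite set and $\mathcal C,\mathcal D$ are families of subsets of $X$ ($\mathcal C$-edges and $\mathcal D$-edges). A proper $k$-coloring is a map from $X$ to a set of $k$ colors such that every $\mathcal C$-edge contains two vertices of a common color and every $\mathcal D$-edge contains two vertices of distinct colors; it is strict if all $k$ colors are used. Colorings are identified with partitions of $X$ into color classes. The feasible set is the set of $k$ for which a strict $k$-coloring exists; $r_k$ is the number of partitions arising as strict $k$-colorings. $\mathcal H$ is a one-realization of $S$ if its feasible set is $S$ and $r_k=1$ for all $k\in S$. Construction, for any integers $m_1>m_2>\cdots>m_r\ge2$ with $T=(m_1,\ldots,m_r)$: vertices are $r$-tuples of integers; $[m]=\{1,\ldots,m\}$. For $t\in\{2,\ldots,r\}$ and integer $j$, let $u_t(j)=(j,\ldots,j,m_t,m_{t+1},\ldots,m_r)$ and $v_t(j)=(j,\ldots,j,1,\ldots,1)$, with $j$ repeated $t-1$ times in both. Then $X_T=\{(m_1,\ldots,m_r)\}\cup\{(i,\ldots,i): i\in[m_r-1]\}\cup\{u_t(j),v_t(j): 2\le t\le r,\ m_t\le j\le m_{t-1}-1\}$; $\mathcal D_T$ = all pairs $\{(x_1,\ldots,x_r),(y_1,\ldots,y_r)\}$ of elements of $X_T$ with $x_i\ne y_i$ for every $i\in[r]$; $\mathcal C^{\star}_T$ consists of, for each $t\in\{2,\ldots,r\}$: the triples $\{u_t(j),v_t(j),v_t(j-1)\}$ for $m_t+1\le j\le m_{t-1}-1$;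 the triples $\{v_t(j),u_t(j),u_t(j+1)\}$ for $m_t\le j\le m_{t-1}-1$; and the triple $\{u_t(m_t),v_t(m_t),(1,\ldots,1)\}$. $\mathcal H^{\star}_T=(X_T,\mathcal C^{\star}_T,\mathcal D_T)$. Here this is applied with $r=s-1$ and $T=(n_1,\ldots,n_{s-2},n_s)$, and $e_2$ is the triple $\{v_{s-1}(n_s),u_{s-1}(n_s),(1,\ldots,1)\}$ of $\mathcal C^{\star}_T$. *)

theory Defs
  imports Main
begin

record 'a mixed_hypergraph =
  vertices :: "'a set"
  c_edges :: "'a set set"
  d_edges :: "'a set set"

definition is_mixed_hypergraph :: "'a mixed_hypergraph \<Rightarrow> bool" where
  "is_mixed_hypergraph H \<longleftrightarrow>
     finite (vertices H) \<and> c_edges H \<subseteq> Pow (vertices H) \<and> d_edges H \<subseteq> Pow (vertices H)"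

text \<open>The set of \<open>k\<close> colors is \<open>{1..k}\<close>; values of a coloring outside the vertex set are
  irrelevant.\<close>

definition proper_coloring :: "'a mixed_hypergraph \<Rightarrow> nat \<Rightarrow> ('a \<Rightarrow> nat) \<Rightarrow> bool" where
  "proper_coloring H k c \<longleftrightarrow>
     c ` vertices H \<subseteq> {1..k} \<and>
     (\<forall>e\<in>c_edges H. \<exists>x\<in>e. \<exists>y\<in>e. x \<noteq> y \<and> c x = c y) \<and>
     (\<forall>e\<in>d_edges H. \<exists>x\<in>e. \<exists>y\<in>e. c x \<noteq> c y)"

definition strict_coloring :: "'a mixed_hypergraph \<Rightarrow> nat \<Rightarrow> ('a \<Rightarrow> nat) \<Rightarrow> bool" where
  "strict_coloring H k c \<longleftrightarrow> proper_coloring H k c \<and> c ` vertices H = {1..k}"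

definition color_classes :: "'a mixed_hypergraph \<Rightarrow> nat \<Rightarrow> ('a \<Rightarrow> nat) \<Rightarrow> 'a set set" where
  "color_classes H k c = (\<lambda>i. {x \<in> vertices H. c x = i}) ` {1..k}"

definition feasible_set :: "'a mixed_hypergraph \<Rightarrow> nat set" where
  "feasible_set H = {k. \<exists>c. strict_coloring H k c}"

text \<open>The number \<open>r\<^sub>k\<close>.\<close>

definition num_strict_partitions :: "'a mixed_hypergraph \<Rightarrow> nat \<Rightarrow> nat" where
  "num_strict_partitions H k = card {color_classes H k c | c. strict_coloring H k c}"

definition one_realization :: "'a mixed_hypergraph \<Rightarrow> nat set \<Rightarrow> bool" where
  "one_realization H S \<longleftrightarrow>
     is_mixed_hypergraph H \<and> feasible_set H = S \<and> (\<forall>k\<in>S. num_strict_partitions H k = 1)"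

text \<open>
  An \<open>r\<close>-tuple of integers is a list of length \<open>r\<close>; all entries that occur are
  positive, so they are taken in \<^typ>\<open>nat\<close>. Tuples are indexed from \<open>1\<close> in the mathematics, so
  the entry \<open>m\<^sub>t\<close> of \<open>T = (m\<^sub>1, \<dots>, m\<^sub>r)\<close> is \<open>T ! (t - 1)\<close>. The construction is meant for
  \<open>m\<^sub>1 > \<dots> > m\<^sub>r \<ge> 2\<close>.
\<close>

definition ent :: "nat list \<Rightarrow> nat \<Rightarrow> nat" where
  "ent T t = T ! (t - 1)"

text \<open>\<open>drop (t - 1) T\<close> is \<open>(m\<^sub>t, \<dots>, m\<^sub>r)\<close>.\<close>

definition u_vertex :: "nat list \<Rightarrow> nat \<Rightarrow> nat \<Rightarrow> nat list" where
  "u_vertex T t j = replicate (t - 1) j @ drop (t - 1) T"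

definition v_vertex :: "nat list \<Rightarrow> nat \<Rightarrow> nat \<Rightarrow> nat list" where
  "v_vertex T t j = replicate (t - 1) j @ replicate (length T - (t - 1)) 1"

definition X_verts :: "nat list \<Rightarrow> nat list set" where
  "X_verts T =
     {T} \<union> {replicate (length T) i | i. i \<in> {1..ent T (length T) - 1}} \<union>
     (\<Union>t\<in>{2..length T}. \<Union>j\<in>{ent T t..ent T (t - 1) - 1}. {u_vertex T t j, v_vertex T t j})"

definition D_edges :: "nat list \<Rightarrow> nat list set set" where
  "D_edges T =
     {{x, y} | x y. x \<in> X_verts T \<and> y \<in> X_verts T \<and> (\<forall>i\<in>{1..length T}. ent x i \<noteq> ent y i)}"

definition C_star_edges :: "nat list \<Rightarrow> nat list set set" where
  "C_star_edges T =
     (\<Union>t\<in>{2..length T}.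
        {{u_vertex T t j, v_vertex T t j, v_vertex T t (j - 1)} | j.
           j \<in> {ent T t + 1..ent T (t - 1) - 1}} \<union>
        {{v_vertex T t j, u_vertex T t j, u_vertex T t (j + 1)} | j.
           j \<in> {ent T t..ent T (t - 1) - 1}} \<union>
        {{u_vertex T t (ent T t), v_vertex T t (ent T t), replicate (length T) 1}})"

definition H_star :: "nat list \<Rightarrow> nat list mixed_hypergraph" where
  "H_star T = \<lparr>vertices = X_verts T, c_edges = C_star_edges T, d_edges = D_edges T\<rparr>"

definition delete_c_edge :: "'a mixed_hypergraph \<Rightarrow> 'a set \<Rightarrow> 'a mixed_hypergraph" where
  "delete_c_edge H e = H\<lparr>c_edges := c_edges H - {e}\<rparr>"

text \<open>For \<open>n\<^sub>1, \<dots>, n\<^sub>s\<close> given as \<open>n 1, \<dots>, n s\<close>: the tuple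
  \<open>T = (n\<^sub>1, \<dots>, n\<^bsub>s-2\<^esub>, n\<^sub>s)\<close>, and \<open>e\<^sub>2\<close>, whose elements are \<open>(s - 1)\<close>-tuples.\<close>

definition T_of :: "(nat \<Rightarrow> nat) \<Rightarrow> nat \<Rightarrow> nat list" where
  "T_of n s = map n [1..<s - 1] @ [n s]"

definition e2_of :: "(nat \<Rightarrow> nat) \<Rightarrow> nat \<Rightarrow> nat list set" where
  "e2_of n s =
     {replicate (s - 2) (n s) @ [1], replicate (s - 1) (n s), replicate (s - 1) 1}"

definition H_star1 :: "(nat \<Rightarrow> nat) \<Rightarrow> nat \<Rightarrow> nat list mixed_hypergraph" where
  "H_star1 n s = delete_c_edge (H_star (T_of n s)) (e2_of n s)"

end

theory Submission
  imports Defs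
begin

text \<open>
  In coordinates the vertices are \<open>U j = (min j m\<^sub>1, \<dots>, min j m\<^sub>r)\<close> for \<open>1 \<le> j \<le> m\<^sub>1\<close> and the
  tuples \<open>V j\<close>, for \<open>m\<^sub>r \<le> j < m\<^sub>1\<close>, whose entries are \<open>j\<close> where \<open>j < m\<^sub>i\<close> and \<open>1\<close> elsewhere.
  Each coordinate is a strict coloring with \<open>m\<^sub>i\<close> colors. Conversely, in a proper coloring,
  \<open>U (j + 1)\<close> and \<open>V (j + 1)\<close> having the same color forces the same for \<open>U j\<close> and \<open>V j\<close>, so there
  is a threshold \<open>p\<close> below which \<open>U j\<close> and \<open>V j\<close> agree and from which on all \<open>U j\<close> have the same
  color. The \<open>\<C>\<close>-edges force \<open>p\<close> to be some \<open>m\<^sub>i\<close> and \<open>V j\<close> to have the color of \<open>U 1\<close> for \<open>j \<ge> p\<close>,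
  which gives the \<open>i\<close>-th coordinate. The only freedom left by deleting \<open>e\<^sub>2\<close> is that for
  \<open>p = m\<^sub>r\<close> the vertices \<open>V j\<close> with \<open>j < m\<^bsub>r-1\<^esub>\<close> may share a new color, which yields
  one coloring with \<open>m\<^sub>r + 1\<close> colors.
\<close>

section \<open>Strict colorings up to renaming of colors, and a criterion for
  one-realizations\<close>

lemma color_classes_strict:
  assumes "strict_coloring H k c"
  shows "color_classes H k c = (\<lambda>x. {y \<in> vertices H. c y = c x}) ` vertices H"
proof -
  have "{1..k} = c ` vertices H"
    using assms by (simp add: strict_coloring_def)
  then show ?thesis
    by (simp add: color_classes_def image_image)
qed

text \<open>Both colorings use all their colors, so \<open>g\<close> maps \<open>{1..p}\<close> onto
  \<open>{1..k}\<close>; being injective, it merely renames the colors.\<close>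

lemma strict_coloring_factor:
  assumes c: "strict_coloring H k c" and d: "strict_coloring H p d"
    and factor: "\<And>x. x \<in> vertices H \<Longrightarrow> c x = g (d x)" and inj: "inj_on g {1..p}"
  shows "k = p" and "color_classes H k c = color_classes H p d"
proof -
  have dim: "d ` vertices H = {1..p}" and cim: "c ` vertices H = {1..k}"
    using c d by (simp_all add: strict_coloring_def)
  have "c ` vertices H = g ` d ` vertices H"
    using factor by (auto simp: image_iff)
  then have "{1..k} = g ` {1..p}"
    using dim cim by simp
  then have "card {1..k} = card {1..p}"
    using inj by (simp add: card_image)
  then show "k = p" by simp
  have "c y = c x \<longleftrightarrow> d y = d x" if "x \<in> vertices H" "y \<in> vertices H" for x y
    using that factor dim inj by (metis image_eqI inj_on_eq_iff)
  then show "color_classes H k c = color_classes H p d"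
    unfolding color_classes_strict[OF c] color_classes_strict[OF d]
    by (intro image_cong refl) auto
qed

text \<open>Feasibility and uniqueness both reduce to a list of model colorings \<open>d p\<close>.
  In \<open>factor\<close>, \<open>p\<close> is tied to \<open>k\<close> only through
  \<open>g\<close>; \<open>strict_coloring_factor\<close> then yields \<open>p = k\<close>.\<close>

lemma one_realizationI:
  assumes "is_mixed_hypergraph H"
    and d: "\<And>p. p \<in> S \<Longrightarrow> strict_coloring H p (d p)"
    and factor: "\<And>k c. strict_coloring H k c \<Longrightarrow>
      \<exists>p\<in>S. \<exists>g. inj_on g {1..p} \<and> (\<forall>x\<in>vertices H. c x = g (d p x))"
  shows "one_realization H S"
proof -
  have unique: "k \<in> S \<and> color_classes H k c = color_classes H k (d k)"
    if c: "strict_coloring H k c" for k c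
  proof -
    obtain p g where "p \<in> S" "inj_on g {1..p}" "\<forall>x\<in>vertices H. c x = g (d p x)"
      using factor[OF c] by blast
    then show ?thesis
      using strict_coloring_factor[OF c d] by metis
  qed
  have "num_strict_partitions H k = 1" if "k \<in> S" for k
  proof -
    have "{color_classes H k c | c. strict_coloring H k c} = {color_classes H k (d k)}"
      using unique d[OF that] by blast
    then show ?thesis by (simp add: num_strict_partitions_def)
  qed
  moreover have "feasible_set H = S"
    unfolding feasible_set_def using unique d by blast
  ultimately show ?thesis
    using assms(1) by (simp add: one_realization_def)
qed

section \<open>Color sequences with a threshold\<close>

text \<open>In the application \<open>cu j\<close>, \<open>cv j\<close> are the colors of
  \<open>U j\<close>, \<open>V j\<close>, and \<open>A\<close> is the set of entries, with
  \<open>m < m'\<close> its two smallest elements and \<open>M\<close> its largest.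
  \<open>uu\<close> and \<open>vu\<close> come from D-edges, \<open>c1\<close> to \<open>c3\<close>
  from C-edges. The strict \<open>m < j\<close> in \<open>c3\<close> reflects the deleted edge and
  is the source of the second outcome.\<close>

lemma threshold_coloring:
  fixes cu cv :: "nat \<Rightarrow> 'c" and m m' M :: nat
  assumes m: "2 \<le> m" "m < m'" "m' \<le> M" "m \<in> A" "M \<in> A"
    and A: "\<And>j. j \<in> A \<Longrightarrow> j = m \<or> m' \<le> j" "m' \<in> A"
    and uu: "\<And>j k. \<lbrakk>1 \<le> j; j < m; j < k; k \<le> M\<rbrakk> \<Longrightarrow> cu j \<noteq> cu k"
    and vu: "\<And>j k. \<lbrakk>m \<le> j; j < M; 2 \<le> k; k \<le> M; k \<noteq> j\<rbrakk> \<Longrightarrow> cv j \<noteq> cu k"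
    and c1: "\<And>j. \<lbrakk>m \<le> j; j < M\<rbrakk> \<Longrightarrow> cu j = cv j \<or> cu j = cu (j + 1)"
    and c2: "\<And>j. \<lbrakk>m \<le> j; j < M; j \<notin> A\<rbrakk> \<Longrightarrow> cu j = cv j \<or> cv j = cv (j - 1)"
    and c3: "\<And>j. \<lbrakk>m < j; j < M; j \<in> A\<rbrakk> \<Longrightarrow> cu j = cv j \<or> cv j = cu 1"
  obtains p where "p \<in> A" "m \<le> p" "inj_on cu {1..p}"
      "\<And>j. \<lbrakk>1 \<le> j; j \<le> M\<rbrakk> \<Longrightarrow> cu j = cu (min j p)"
      "\<And>j. \<lbrakk>m \<le> j; j < M\<rbrakk> \<Longrightarrow> cv j = cu (if j < p then j else 1)"
    | "inj_on cu {1..m}" "cv m \<notin> cu ` {1..m}"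
      "\<And>j. \<lbrakk>1 \<le> j; j \<le> M\<rbrakk> \<Longrightarrow> cu j = cu (min j m)"
      "\<And>j. \<lbrakk>m \<le> j; j < M\<rbrakk> \<Longrightarrow> cv j = (if j < m' then cv m else cu 1)"
proof -
  \<comment> \<open>\<open>M\<close> is the fallback, since \<open>cv\<close> is constrained only
    below \<open>M\<close>.\<close>
  define p where "p = (LEAST p. m \<le> p \<and> (p = M \<or> cu p \<noteq> cv p))"
  have p: "m \<le> p" "p = M \<or> cu p \<noteq> cv p"
    using LeastI[of "\<lambda>p. m \<le> p \<and> (p = M \<or> cu p \<noteq> cv p)" M] m by (auto simp: p_def)
  have "p \<le> M"
    using m unfolding p_def by (intro Least_le) simp
  have below: "cu j = cv j" if "m \<le> j" "j < p" for j
    using that not_less_Least[of j "\<lambda>p. m \<le> p \<and> (p = M \<or> cu p \<noteq> cv p)"]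
    by (auto simp: p_def)
  have above: "cu j \<noteq> cv j" if "p \<le> j" "j < M" for j
    using that
  proof (induction j rule: dec_induct)
    case base
    then show ?case using p by auto
  next
    case (step j)
    \<comment> \<open>A disagreement at \<open>j\<close> passes to \<open>j + 1\<close>:
      \<open>c1\<close> can only hold by its second alternative, and \<open>vu\<close> separates
      \<open>cv (j + 1)\<close> from \<open>cu j\<close>.\<close>
    then have "cu j = cu (j + 1)" "cv (j + 1) \<noteq> cu j"
      using c1[of j] vu[of "j + 1" j] p m by auto
    then show ?case by auto
  qed
  have const: "cu j = cu p" if "p \<le> j" "j \<le> M" for j
    using that
  proof (induction j rule: dec_induct)
    case (step j)
    then show ?case using c1[of j] above[of j] p by auto
  qed simp
  have cu_min: "cu j = cu (min j p)" if "1 \<le> j" "j \<le> M" for j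
    using const[of j] that by (cases "j < p") auto
  have "cu j \<noteq> cu k" if "1 \<le> j" "j < k" "k \<le> p" for j k
  proof (cases "j < m")
    case True
    then show ?thesis using uu that \<open>p \<le> M\<close> by simp
  next
    case False
    \<comment> \<open>From \<open>m\<close> on \<open>uu\<close> is silent, but below the threshold
      \<open>cv j\<close> can stand in for \<open>cu j\<close>, and \<open>vu\<close> applies to
      it.\<close>
    then have "cu j = cv j" using below that by simp
    moreover have "cv j \<noteq> cu k" using False that m \<open>p \<le> M\<close> by (intro vu) auto
    ultimately show ?thesis by simp
  qed
  then have inj: "inj_on cu {1..p}"
    by (intro linorder_inj_onI) auto
  \<comment> \<open>Otherwise \<open>c2\<close> at \<open>p\<close> gives \<open>cv p\<close> the
    value \<open>cv (p - 1)\<close>, which equals \<open>cu (p - 1)\<close> below the threshold;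
    \<open>vu\<close> forbids this.\<close>
  have "p \<in> A"
  proof (rule ccontr)
    assume "p \<notin> A"
    then have "m < p" "p < M" using p \<open>p \<le> M\<close> m by (auto simp: le_less)
    then have "cv p = cv (p - 1)" using c2[of p] above[of p] \<open>p \<notin> A\<close> by auto
    also have "\<dots> = cu (p - 1)" using below[of "p - 1"] \<open>m < p\<close> by simp
    finally have "cv p = cu (p - 1)" .
    moreover have "cv p \<noteq> cu (p - 1)" using \<open>m < p\<close> \<open>p < M\<close> m by (intro vu) auto
    ultimately show False by simp
  qed
  \<comment> \<open>At elements of \<open>A\<close> the value is fixed by \<open>c3\<close>, which
    starts only beyond \<open>m\<close>; between them \<open>c2\<close> carries it on.\<close>
  have v_above: "cv j = cu 1" if q: "q \<in> A" "m < q" "p \<le> q" and j: "q \<le> j" "j < M" for q j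
    using j
  proof (induction j rule: dec_induct)
    case base
    then show ?case using q c3[of q] above[of q] by auto
  next
    case (step j)
    then show ?case
      using q c2[of "Suc j"] c3[of "Suc j"] above[of "Suc j"] by (cases "Suc j \<in> A") auto
  qed
  \<comment> \<open>No element of \<open>A\<close> lies strictly between \<open>m\<close> and
    \<open>m'\<close>, so \<open>c2\<close> spreads the value \<open>cv m\<close>, whatever it is,
    over this gap.\<close>
  have v_m: "cv j = cv m" if "p = m" "m \<le> j" "j < m'" for j
    using that(2,3)
  proof (induction j rule: dec_induct)
    case (step j)
    then have "Suc j \<notin> A" using A(1)[of "Suc j"] by auto
    then show ?case
      using step that(1) m c2[of "Suc j"] above[of "Suc j"] by auto
  qed simp
  show thesis
  proof (cases "p = m \<and> cv m \<noteq> cu 1")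
    case False
    have "cv j = cu (if j < p then j else 1)" if "m \<le> j" "j < M" for j
    proof -
      consider "j < p" | "m < p" "p \<le> j" | "p = m" "j < m'" | "p = m" "m' \<le> j"
        using p by linarith
      then show ?thesis
      proof cases
        case 1
        then show ?thesis using below[of j] that by simp
      next
        case 2
        then show ?thesis using v_above[of p j] \<open>p \<in> A\<close> that by simp
      next
        case 3
        then show ?thesis using v_m[of j] False that by simp
      next
        case 4
        then show ?thesis using v_above[of m' j] \<open>m' \<in> A\<close> m(2) that by simp
      qed
    qed
    then show thesis using that(1) \<open>p \<in> A\<close> p(1) inj cu_min by blast
  next
    case True
    have "cv m \<noteq> cu k" if "k \<in> {1..m}" for k
    \<comment> \<open>These are the two values that \<open>vu\<close> leaves open:
      \<open>k = 1\<close> is excluded by the case assumption, \<open>k = m\<close> by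
      \<open>above\<close>.\<close>
    proof (cases "k = 1 \<or> k = m")
      case True
      then show ?thesis using \<open>p = m \<and> cv m \<noteq> cu 1\<close> above[of m] m by auto
    next
      case False
      then show ?thesis using that m by (intro vu) auto
    qed
    moreover have "cv j = (if j < m' then cv m else cu 1)" if "m \<le> j" "j < M" for j
      using that v_m[of j] v_above[of m' j] True m(2) \<open>m' \<in> A\<close> by (cases "j < m'") auto
    ultimately show thesis using that(2) True inj cu_min by blast
  qed
qed

section \<open>Decreasing tuples and the indexing of the vertices by a single number\<close>

locale decreasing_tuple =
  fixes T :: "nat list"
  assumes decreasing: "sorted_wrt (>) T"
    and length_ge: "2 \<le> length T"
    and last_ge: "2 \<le> last T"
begin

definition U :: "nat \<Rightarrow> nat list" where
  "U j = map (min j) T"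

definition V :: "nat \<Rightarrow> nat list" where
  "V j = map (\<lambda>a. if j < a then j else 1) T"

abbreviation "second_last \<equiv> T ! (length T - 2)"

lemma T_nth_less: "\<lbrakk>i < k; k < length T\<rbrakk> \<Longrightarrow> T ! k < T ! i"
  using decreasing by (simp add: sorted_wrt_iff_nth_less)

lemma T_nth_le: "\<lbrakk>i \<le> k; k < length T\<rbrakk> \<Longrightarrow> T ! k \<le> T ! i"
  using T_nth_less[of i k] by (cases "i = k") auto

lemma T_nonempty: "T \<noteq> []"
  using length_ge by auto

lemma last_T: "last T = T ! (length T - 1)"
  using T_nonempty by (rule last_conv_nth)

lemma hd_T: "hd T = T ! 0"
  using T_nonempty by (rule hd_conv_nth)

lemma last_le: "a \<in> set T \<Longrightarrow> last T \<le> a"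
  using T_nth_le by (auto simp: in_set_conv_nth last_T)

lemma le_hd: "a \<in> set T \<Longrightarrow> a \<le> hd T"
  using T_nth_le by (auto simp: in_set_conv_nth hd_T)

lemma last_less_second: "last T < second_last"
  using T_nth_less[of "length T - 2" "length T - 1"] length_ge by (simp add: last_T)

lemma second_in: "second_last \<in> set T"
  using length_ge by (intro nth_mem) simp

text \<open>Supplies the gap in the set of entries over which \<open>threshold_coloring\<close> lets
  a new color spread.\<close>

lemma second_le:
  assumes "a \<in> set T"
  shows "a = last T \<or> second_last \<le> a"
proof -
  obtain i where "i < length T" "a = T ! i"
    using assms by (auto simp: in_set_conv_nth)
  moreover have "i \<le> length T - 2 \<or> i = length T - 1"
    using \<open>i < length T\<close> by linarith
  ultimately show ?thesis
    using T_nth_le[of i "length T - 2"] T_nonempty \<open>a = T ! i\<close> by (auto simp: last_T)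
qed

lemma last_less_hd: "last T < hd T"
  using last_less_second le_hd[OF second_in] by simp

lemma ent_last: "ent T (length T) = last T"
  by (simp add: ent_def last_T)

lemma ent_less: "\<lbrakk>2 \<le> t; t \<le> length T\<rbrakk> \<Longrightarrow> ent T t < ent T (t - 1)"
  using T_nth_less[of "t - 2" "t - 1"] by (simp add: ent_def numeral_2_eq_2)

lemma ent_in: "\<lbrakk>1 \<le> t; t \<le> length T\<rbrakk> \<Longrightarrow> ent T t \<in> set T"
  by (simp add: ent_def)

text \<open>The half-open intervals from \<open>m_t\<close> to \<open>m_(t-1)\<close> tile the range
  from \<open>last T\<close> to \<open>hd T\<close>, so the block \<open>t\<close> can be recovered
  from \<open>j\<close>.\<close>

lemma exists_ent_interval:
  assumes "last T \<le> j" "j < hd T"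
  shows "\<exists>t\<in>{2..length T}. ent T t \<le> j \<and> j < ent T (t - 1)"
proof -
  \<comment> \<open>Position of the first entry that is at most \<open>j\<close>, counted from 0;
    hence the block is \<open>t = k + 1\<close>.\<close>
  define k where "k = (LEAST k. k < length T \<and> T ! k \<le> j)"
  have k: "k < length T" "T ! k \<le> j"
    using LeastI[of "\<lambda>k. k < length T \<and> T ! k \<le> j" "length T - 1"] assms length_ge
    by (auto simp: k_def last_T)
  have "k \<noteq> 0" using k assms(2) by (metis hd_T linorder_not_le)
  moreover have "j < T ! (k - 1)"
    using not_less_Least[of "k - 1" "\<lambda>k. k < length T \<and> T ! k \<le> j"] k \<open>k \<noteq> 0\<close>
    by (auto simp: k_def[symmetric])
  ultimately show ?thesis
    using k by (intro bexI[of _ "k + 1"]) (auto simp: ent_def)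
qed

lemma not_in_between:
  assumes "t \<in> {2..length T}" "ent T t < j" "j < ent T (t - 1)"
  shows "j \<notin> set T"
proof
  assume "j \<in> set T"
  then obtain i where i: "i < length T" "j = T ! i" by (auto simp: in_set_conv_nth)
  show False
  proof (cases "i \<le> t - 2")
    case True
    then have "T ! (t - 2) \<le> T ! i" using assms(1) by (intro T_nth_le) auto
    then show False using assms i by (simp add: ent_def numeral_2_eq_2)
  next
    case False
    then have "T ! i \<le> T ! (t - 1)" using i by (intro T_nth_le) auto
    then show False using assms i by (simp add: ent_def)
  qed
qed

text \<open>The right end \<open>j = m_(t-1)\<close> is included: there \<open>u_t(j)\<close> is
  also the first \<open>u\<close> vertex of the next block, or \<open>T\<close> itself if
  \<open>t = 2\<close>. The triples containing \<open>u_t(j+1)\<close> reach this end.\<close>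

lemma u_vertex_eq:
  assumes "2 \<le> t" "t \<le> length T" "ent T t \<le> j" "j \<le> ent T (t - 1)"
  shows "u_vertex T t j = U j"
proof (rule nth_equalityI)
  fix i assume "i < length (u_vertex T t j)"
  then have i: "i < length T" using assms by (simp add: u_vertex_def)
  show "u_vertex T t j ! i = U j ! i"
  proof (cases "i < t - 1")
    case True
    then have "T ! (t - 2) \<le> T ! i" using i assms by (intro T_nth_le) auto
    then show ?thesis
      using True i assms by (simp add: u_vertex_def U_def nth_append ent_def numeral_2_eq_2)
  next
    case False
    then have "T ! i \<le> T ! (t - 1)" using i by (intro T_nth_le) auto
    then show ?thesis
      using False i assms by (simp add: u_vertex_def U_def nth_append ent_def)
  qed
qed (use assms in \<open>simp add: u_vertex_def U_def\<close>)

text \<open>Here the right end is excluded: at \<open>j = m_(t-1)\<close>, coordinate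
  \<open>t - 1\<close> of \<open>V j\<close> has already dropped to 1.\<close>

lemma v_vertex_eq:
  assumes "2 \<le> t" "t \<le> length T" "ent T t \<le> j" "j < ent T (t - 1)"
  shows "v_vertex T t j = V j"
proof (rule nth_equalityI)
  fix i assume "i < length (v_vertex T t j)"
  then have i: "i < length T" using assms by (simp add: v_vertex_def)
  show "v_vertex T t j ! i = V j ! i"
  proof (cases "i < t - 1")
    case True
    then have "T ! (t - 2) \<le> T ! i" using i assms by (intro T_nth_le) auto
    then show ?thesis
      using True i assms by (simp add: v_vertex_def V_def nth_append ent_def numeral_2_eq_2)
  next
    case False
    then have "T ! i \<le> T ! (t - 1)" using i by (intro T_nth_le) auto
    then show ?thesis
      using False i assms by (simp add: v_vertex_def V_def nth_append ent_def)
  qed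
qed (use assms in \<open>simp add: v_vertex_def V_def\<close>)

lemma replicate_eq_U: "i \<le> last T \<Longrightarrow> replicate (length T) i = U i"
  using last_le by (auto simp: U_def intro!: nth_equalityI) (metis min.absorb1 nth_mem order_trans)

lemma T_eq_U: "T = U (hd T)"
  using le_hd by (auto simp: U_def intro!: nth_equalityI)

text \<open>The constant tuples are the \<open>U j\<close> with \<open>j < last T\<close>, the
  blocks tile the indices from \<open>last T\<close> up to \<open>hd T\<close>, and \<open>T\<close>
  is \<open>U (hd T)\<close>.\<close>

lemma X_verts_eq: "X_verts T = U ` {1..hd T} \<union> V ` {last T..<hd T}"
proof -
  have interval: "{ent T t..ent T (t - 1) - 1} = {ent T t..<ent T (t - 1)}"
    if "t \<in> {2..length T}" for t
    using that ent_less[of t] by auto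
  have "(\<Union>t\<in>{2..length T}. \<Union>j\<in>{ent T t..ent T (t - 1) - 1}. {u_vertex T t j, v_vertex T t j})
      = (\<Union>t\<in>{2..length T}. \<Union>j\<in>{ent T t..<ent T (t - 1)}. {U j, V j})"
    using interval by (intro SUP_cong) (auto simp: u_vertex_eq v_vertex_eq)
  also have "\<dots> = (\<Union>j\<in>(\<Union>t\<in>{2..length T}. {ent T t..<ent T (t - 1)}). {U j, V j})"
    by blast
  also have "(\<Union>t\<in>{2..length T}. {ent T t..<ent T (t - 1)}) = {last T..<hd T}"
  proof
    show "(\<Union>t\<in>{2..length T}. {ent T t..<ent T (t - 1)}) \<subseteq> {last T..<hd T}"
    proof
      fix j assume "j \<in> (\<Union>t\<in>{2..length T}. {ent T t..<ent T (t - 1)})"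
      then obtain t where "t \<in> {2..length T}" "ent T t \<le> j" "j < ent T (t - 1)" by auto
      then show "j \<in> {last T..<hd T}"
        using last_le[OF ent_in[of t]] le_hd[OF ent_in[of "t - 1"]] by force
    qed
    show "{last T..<hd T} \<subseteq> (\<Union>t\<in>{2..length T}. {ent T t..<ent T (t - 1)})"
      using exists_ent_interval by fastforce
  qed
  finally have "X_verts T = {U (hd T)} \<union> {replicate (length T) i | i. i \<in> {1..last T - 1}}
      \<union> (\<Union>j\<in>{last T..<hd T}. {U j, V j})"
    unfolding X_verts_def ent_last using T_eq_U by simp
  also have "{replicate (length T) i | i. i \<in> {1..last T - 1}} = U ` {1..<last T}"
    unfolding Setcompr_eq_image using last_ge by (intro image_cong) (auto simp: replicate_eq_U)
  also have "{U (hd T)} \<union> U ` {1..<last T} \<union> (\<Union>j\<in>{last T..<hd T}. {U j, V j})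
      = U ` ({hd T} \<union> {1..<last T} \<union> {last T..<hd T}) \<union> V ` {last T..<hd T}"
    by blast
  also have "{hd T} \<union> {1..<last T} \<union> {last T..<hd T} = {1..hd T}"
    using last_less_hd last_ge by auto
  finally show ?thesis .
qed

lemma U_in_X: "\<lbrakk>1 \<le> j; j \<le> hd T\<rbrakk> \<Longrightarrow> U j \<in> X_verts T"
  by (auto simp: X_verts_eq)

lemma V_in_X: "\<lbrakk>last T \<le> j; j < hd T\<rbrakk> \<Longrightarrow> V j \<in> X_verts T"
  by (auto simp: X_verts_eq)

lemma U_nth: "i < length T \<Longrightarrow> U j ! i = min j (T ! i)"
  by (simp add: U_def)

lemma V_nth: "i < length T \<Longrightarrow> V j ! i = (if j < T ! i then j else 1)"
  by (simp add: V_def)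

lemma T_nth_ge: "i < length T \<Longrightarrow> 2 \<le> T ! i"
  using last_le[of "T ! i"] last_ge by simp

section \<open>D-edges and distinctness of vertices\<close>

lemma D_edgesI:
  assumes "x \<in> X_verts T" "y \<in> X_verts T" "\<And>i. i < length T \<Longrightarrow> x ! i \<noteq> y ! i"
  shows "{x, y} \<in> D_edges T"
proof -
  have "\<forall>i\<in>{1..length T}. ent x i \<noteq> ent y i"
    unfolding ent_def by (intro ballI assms(3)) auto
  then show ?thesis
    using assms(1,2) unfolding D_edges_def by blast
qed

lemma D_edgesE:
  assumes "e \<in> D_edges T"
  obtains x y where "e = {x, y}" "x \<in> X_verts T" "y \<in> X_verts T"
    "\<And>i. i < length T \<Longrightarrow> x ! i \<noteq> y ! i"
proof -
  obtain x y where "e = {x, y}" "x \<in> X_verts T" "y \<in> X_verts T"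
    and "\<forall>i\<in>{1..length T}. ent x i \<noteq> ent y i"
    using assms unfolding D_edges_def by blast
  moreover have "x ! i \<noteq> y ! i" if "i < length T" for i
    using calculation(4) that by (auto simp: ent_def dest!: bspec[of _ _ "Suc i"])
  ultimately show thesis using that by blast
qed

text \<open>As \<open>j\<close> lies below every entry, all coordinates of \<open>U j\<close> equal
  \<open>j\<close>, while those of \<open>U k\<close> exceed \<open>j\<close>.\<close>

lemma D_edge_UU:
  assumes "1 \<le> j" "j < last T" "j < k" "k \<le> hd T"
  shows "{U j, U k} \<in> D_edges T"
proof (rule D_edgesI)
  fix i assume i: "i < length T"
  then have "last T \<le> T ! i" using last_le by simp
  then show "U j ! i \<noteq> U k ! i" using i assms by (auto simp: U_nth min_def)
qed (use assms U_in_X in auto)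

text \<open>Where an entry \<open>a\<close> exceeds \<open>j\<close>, the coordinates are
  \<open>j\<close> and \<open>min k a\<close>, and neither \<open>k\<close> nor \<open>a\<close> is
  \<open>j\<close>; elsewhere they are 1 and at least 2.\<close>

lemma D_edge_VU:
  assumes "last T \<le> j" "j < hd T" "2 \<le> k" "k \<le> hd T" "k \<noteq> j"
  shows "{V j, U k} \<in> D_edges T"
proof (rule D_edgesI)
  fix i assume i: "i < length T"
  then show "V j ! i \<noteq> U k ! i" using T_nth_ge[OF i] assms by (auto simp: U_nth V_nth min_def)
qed (use assms U_in_X V_in_X in auto)

text \<open>The last coordinate is 1 for \<open>V j\<close> and at least 2 for
  \<open>U k\<close>.\<close>

lemma U_neq_V:
  assumes "last T \<le> j" "2 \<le> k"
  shows "U k \<noteq> V j"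
proof
  assume "U k = V j"
  then have "U k ! (length T - 1) = V j ! (length T - 1)" by simp
  then show False
    using assms last_ge T_nonempty by (auto simp: U_nth V_nth last_T min_def split: if_splits)
qed

text \<open>The last coordinates agree here, so the first ones are compared: 1 against
  \<open>j\<close>.\<close>

lemma U_1_neq_V:
  assumes "last T \<le> j" "j < hd T"
  shows "U 1 \<noteq> V j"
proof
  assume "U 1 = V j"
  then have "U 1 ! 0 = V j ! 0" by simp
  then show False
    using assms last_ge T_nonempty by (auto simp: U_nth V_nth hd_T)
qed

lemma inj_U: "inj_on U {1..hd T}"
proof (rule inj_onI)
  fix j k assume "j \<in> {1..hd T}" "k \<in> {1..hd T}" "U j = U k"
  then have "U j ! 0 = U k ! 0" by simp
  then show "j = k" using \<open>j \<in> _\<close> \<open>k \<in> _\<close> T_nonempty by (simp add: U_nth hd_T)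
qed

lemma inj_V: "inj_on V {last T..<hd T}"
proof (rule inj_onI)
  fix j k assume "j \<in> {last T..<hd T}" "k \<in> {last T..<hd T}" "V j = V k"
  then have "V j ! 0 = V k ! 0" by simp
  then show "j = k" using \<open>j \<in> _\<close> \<open>k \<in> _\<close> T_nonempty by (simp add: V_nth hd_T)
qed

lemma V_pred_neq:
  assumes "last T < j" "j < hd T"
  shows "V j \<noteq> V (j - 1)"
  using assms by (subst inj_on_eq_iff[OF inj_V]) auto

section \<open>The C-edges in terms of \<open>U\<close> and \<open>V\<close>\<close>

lemma C_edge_VUU:
  assumes "last T \<le> j" "j < hd T"
  shows "{V j, U j, U (j + 1)} \<in> C_star_edges T"
proof -
  obtain t where t: "t \<in> {2..length T}" "ent T t \<le> j" "j < ent T (t - 1)"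
    using exists_ent_interval[OF assms] by blast
  then have "{V j, U j, U (j + 1)} = {v_vertex T t j, u_vertex T t j, u_vertex T t (j + 1)}"
    by (simp add: u_vertex_eq v_vertex_eq)
  moreover have "j \<in> {ent T t..ent T (t - 1) - 1}" using t by auto
  ultimately show ?thesis
    using t(1) unfolding C_star_edges_def by blast
qed

text \<open>A non-entry \<open>j\<close> is not the left end of its block, so \<open>j - 1\<close>
  belongs to the same block.\<close>

lemma C_edge_UVV:
  assumes "last T \<le> j" "j < hd T" "j \<notin> set T"
  shows "{U j, V j, V (j - 1)} \<in> C_star_edges T"
proof -
  obtain t where t: "t \<in> {2..length T}" "ent T t \<le> j" "j < ent T (t - 1)"
    using exists_ent_interval[OF assms(1,2)] by blast
  then have "ent T t \<noteq> j" using assms(3) ent_in[of t] by auto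
  then have "{U j, V j, V (j - 1)} = {u_vertex T t j, v_vertex T t j, v_vertex T t (j - 1)}"
    using t by (simp add: u_vertex_eq v_vertex_eq)
  moreover have "j \<in> {ent T t + 1..ent T (t - 1) - 1}" using t \<open>ent T t \<noteq> j\<close> by auto
  ultimately show ?thesis
    using t(1) unfolding C_star_edges_def by blast
qed

text \<open>An entry can only be the left end of its block, by
  \<open>not_in_between\<close>.\<close>

lemma C_edge_UV1:
  assumes "j \<in> set T" "j < hd T"
  shows "{U j, V j, U 1} \<in> C_star_edges T"
proof -
  obtain t where t: "t \<in> {2..length T}" "ent T t \<le> j" "j < ent T (t - 1)"
    using exists_ent_interval[OF last_le] assms by blast
  then have "ent T t = j" using assms(1) not_in_between[of t j] by (cases "ent T t < j") auto
  then have "{U j, V j, U 1} = {u_vertex T t (ent T t), v_vertex T t (ent T t), replicate (length T) 1}"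
    using t last_ge by (simp add: u_vertex_eq v_vertex_eq replicate_eq_U)
  then show ?thesis
    using t(1) unfolding C_star_edges_def by blast
qed

lemma C_star_edgesE:
  assumes "e \<in> C_star_edges T"
  obtains (VUU) j where "last T \<le> j" "j < hd T" "e = {V j, U j, U (j + 1)}"
    | (UVV) j where "last T < j" "j < hd T" "j \<notin> set T" "e = {U j, V j, V (j - 1)}"
    | (UV1) j where "j \<in> set T" "j < hd T" "e = {U j, V j, U 1}"
proof -
  obtain t where t: "t \<in> {2..length T}" and e:
      "e \<in> {{u_vertex T t j, v_vertex T t j, v_vertex T t (j - 1)} | j.
           j \<in> {ent T t + 1..ent T (t - 1) - 1}} \<union>
        {{v_vertex T t j, u_vertex T t j, u_vertex T t (j + 1)} | j.
           j \<in> {ent T t..ent T (t - 1) - 1}} \<union>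
        {{u_vertex T t (ent T t), v_vertex T t (ent T t), replicate (length T) 1}}"
    using assms unfolding C_star_edges_def by blast
  have less: "ent T t < ent T (t - 1)" using t ent_less by simp
  have range: "last T \<le> ent T t" "ent T (t - 1) \<le> hd T"
    using t by (auto intro!: last_le le_hd ent_in)
  consider (1) j where "j \<in> {ent T t + 1..ent T (t - 1) - 1}"
      "e = {u_vertex T t j, v_vertex T t j, v_vertex T t (j - 1)}"
    | (2) j where "j \<in> {ent T t..ent T (t - 1) - 1}"
      "e = {v_vertex T t j, u_vertex T t j, u_vertex T t (j + 1)}"
    | (3) "e = {u_vertex T t (ent T t), v_vertex T t (ent T t), replicate (length T) 1}"
    using e by blast
  then show thesis
  proof cases
    case 1
    then have j: "ent T t < j" "j < ent T (t - 1)" using less by auto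
    then have "j \<notin> set T" using not_in_between t by blast
    then show thesis
      using UVV[of j] 1 j t range by (simp add: u_vertex_eq v_vertex_eq)
  next
    case 2
    then have "ent T t \<le> j" "j < ent T (t - 1)" using less by auto
    then show thesis
      using VUU[of j] 2 t range by (simp add: u_vertex_eq v_vertex_eq)
  next
    case 3
    then show thesis
      using UV1[of "ent T t"] t range less last_ge ent_in[of t]
      by (simp add: u_vertex_eq v_vertex_eq replicate_eq_U)
  qed
qed

lemma D_edges_subset: "D_edges T \<subseteq> Pow (X_verts T)"
  by (auto elim!: D_edgesE)

lemma C_star_edges_subset: "C_star_edges T \<subseteq> Pow (X_verts T)"
proof
  fix e assume "e \<in> C_star_edges T"
  then show "e \<in> Pow (X_verts T)"
    using last_ge last_less_hd
    by (cases rule: C_star_edgesE) (auto intro!: U_in_X V_in_X dest: last_le)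
qed

section \<open>The hypergraph without \<open>e_2\<close> and its model colorings\<close>

definition H :: "nat list mixed_hypergraph" where
  "H = delete_c_edge (H_star T) {U (last T), V (last T), U 1}"

lemma vertices_H: "vertices H = X_verts T"
  and d_edges_H: "d_edges H = D_edges T"
  and c_edges_H: "c_edges H = C_star_edges T - {{U (last T), V (last T), U 1}}"
  by (simp_all add: H_def delete_c_edge_def H_star_def)

lemma is_mixed_hypergraph_H: "is_mixed_hypergraph H"
proof -
  have "finite (X_verts T)" by (simp add: X_verts_eq)
  then show ?thesis
    using C_star_edges_subset D_edges_subset
    by (auto simp: is_mixed_hypergraph_def vertices_H d_edges_H c_edges_H)
qed

lemma X_vertsE:
  assumes "x \<in> X_verts T"
  obtains j where "1 \<le> j" "j \<le> hd T" "x = U j" | j where "last T \<le> j" "j < hd T" "x = V j"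
  using assms by (auto simp: X_verts_eq)

lemma edge_two:
  "\<lbrakk>x \<in> e; y \<in> e; x \<noteq> y; c x = c y\<rbrakk> \<Longrightarrow> \<exists>x\<in>e. \<exists>y\<in>e. x \<noteq> y \<and> c x = (c y :: nat)"
  by blast

text \<open>D-edges differ in every coordinate by definition. In a C-edge with index
  \<open>j\<close>, the vertices \<open>U j\<close> and \<open>V j\<close> share the value
  \<open>j\<close> if \<open>j < T ! i\<close>; otherwise another pair agrees, both at
  \<open>T ! i\<close> or both at 1.\<close>

lemma strict_coloring_nth:
  assumes i: "i < length T"
  shows "strict_coloring H (T ! i) (\<lambda>x. x ! i)"
proof -
  have Ti: "2 \<le> T ! i" "T ! i \<in> set T" using i T_nth_ge by auto
  have sub: "(\<lambda>x. x ! i) ` X_verts T \<subseteq> {1..T ! i}"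
    using i Ti last_ge by (auto elim!: X_vertsE simp: U_nth V_nth)
  have sup: "{1..T ! i} \<subseteq> (\<lambda>x. x ! i) ` X_verts T"
  proof
    fix k assume "k \<in> {1..T ! i}"
    then have "k = U k ! i" "U k \<in> X_verts T"
      using i le_hd[OF Ti(2)] by (auto simp: U_nth intro!: U_in_X)
    then show "k \<in> (\<lambda>x. x ! i) ` X_verts T" by (rule image_eqI)
  qed
  have C: "\<exists>x\<in>e. \<exists>y\<in>e. x \<noteq> y \<and> x ! i = y ! i" if "e \<in> C_star_edges T" for e
    using that
  proof (cases rule: C_star_edgesE)
    case (VUU j)
    show ?thesis
    proof (cases "j < T ! i")
      case True
      then show ?thesis
        using VUU i last_ge U_neq_V[of j j]
        by (intro edge_two[of "V j" _ "U j"]) (auto simp: U_nth V_nth)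
    next
      case False
      then show ?thesis
        using VUU i last_ge inj_onD[OF inj_U, of j "j + 1"]
        by (intro edge_two[of "U j" _ "U (j + 1)"]) (auto simp: U_nth V_nth)
    qed
  next
    case (UVV j)
    show ?thesis
    proof (cases "j < T ! i")
      case True
      then show ?thesis
        using UVV i last_ge U_neq_V[of j j]
        by (intro edge_two[of "V j" _ "U j"]) (auto simp: U_nth V_nth)
    next
      case False
      \<comment> \<open>This gives \<open>T ! i \<le> j - 1\<close>, so coordinate \<open>i\<close>
        is 1 for \<open>V (j - 1)\<close> as well as for \<open>V j\<close>.\<close>
      moreover have "T ! i \<noteq> j" using UVV Ti by auto
      ultimately show ?thesis
        using UVV i last_ge V_pred_neq[of j]
        by (intro edge_two[of "V j" _ "V (j - 1)"]) (auto simp: V_nth)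
    qed
  next
    case (UV1 j)
    then have "last T \<le> j" using last_le by simp
    show ?thesis
    proof (cases "j < T ! i")
      case True
      then show ?thesis
        using UV1 i last_ge \<open>last T \<le> j\<close> U_neq_V[of j j]
        by (intro edge_two[of "V j" _ "U j"]) (auto simp: U_nth V_nth)
    next
      case False
      then show ?thesis
        using UV1 i Ti \<open>last T \<le> j\<close> U_1_neq_V[of j]
        by (intro edge_two[of "U 1" _ "V j"]) (auto simp: U_nth V_nth)
    qed
  qed
  have D: "\<exists>x\<in>e. \<exists>y\<in>e. x ! i \<noteq> y ! i" if "e \<in> D_edges T" for e
    using that i by (auto elim!: D_edgesE)
  show ?thesis
    unfolding strict_coloring_def proper_coloring_def vertices_H c_edges_H d_edges_H
    using sub sup C D by blast
qed

text \<open>The recolored vertices all have last coordinate 1. Giving them a new common color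
  violates \<open>e_2\<close> and no other C-edge.\<close>

definition extra_coloring :: "nat list \<Rightarrow> nat" where
  "extra_coloring x =
     (if x \<in> V ` {last T..<second_last} then last T + 1 else x ! (length T - 1))"

lemma extra_coloring_U:
  assumes "1 \<le> j" "j \<le> hd T"
  shows "extra_coloring (U j) = min j (last T)"
proof -
  have "U j \<noteq> V k" if "k \<in> {last T..<second_last}" for k
    using U_neq_V[of k j] U_1_neq_V[of k] le_hd[OF second_in] that assms
    by (cases "j = 1") auto
  then have "U j \<notin> V ` {last T..<second_last}" by blast
  then show ?thesis
    using T_nonempty by (simp add: extra_coloring_def U_nth last_T)
qed

lemma extra_coloring_V:
  assumes "last T \<le> j" "j < hd T"
  shows "extra_coloring (V j) = (if j < second_last then last T + 1 else 1)"
proof -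
  have "V j \<in> V ` {last T..<second_last} \<longleftrightarrow> j < second_last"
    using inj_on_image_mem_iff[OF inj_V, of j "{last T..<second_last}"] assms le_hd[OF second_in]
    by auto
  then show ?thesis
    using T_nonempty assms by (auto simp: extra_coloring_def V_nth last_T)
qed

lemma strict_coloring_extra: "strict_coloring H (last T + 1) extra_coloring"
proof -
  note color = extra_coloring_U extra_coloring_V
  have sub: "extra_coloring ` X_verts T \<subseteq> {1..last T + 1}"
    using last_ge by (auto elim!: X_vertsE simp: color)
  have sup: "{1..last T + 1} \<subseteq> extra_coloring ` X_verts T"
  proof
    fix k assume k: "k \<in> {1..last T + 1}"
    show "k \<in> extra_coloring ` X_verts T"
    proof (cases "k = last T + 1")
      case True
      then show ?thesis
        using last_less_second last_less_hd
        by (intro image_eqI[of _ _ "V (last T)"]) (auto simp: color intro: V_in_X)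
    next
      case False
      then show ?thesis
        using k last_less_hd by (intro image_eqI[of _ _ "U k"]) (auto simp: color intro: U_in_X)
    qed
  qed
  have C: "\<exists>x\<in>e. \<exists>y\<in>e. x \<noteq> y \<and> extra_coloring x = extra_coloring y"
    if "e \<in> C_star_edges T" "e \<noteq> {U (last T), V (last T), U 1}" for e
    using that(1)
  proof (cases rule: C_star_edgesE)
    case (VUU j)
    then show ?thesis
      using last_ge inj_onD[OF inj_U, of j "j + 1"]
      by (intro edge_two[of "U j" _ "U (j + 1)"]) (auto simp: color)
  next
    case (UVV j)
    \<comment> \<open>Hence \<open>j\<close> and \<open>j - 1\<close> lie on the same side of
      \<open>second_last\<close>, and \<open>V j\<close>, \<open>V (j - 1)\<close> get the same
      color.\<close>
    then have "j \<noteq> second_last" using second_in by auto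
    then show ?thesis
      using UVV V_pred_neq[of j]
      by (intro edge_two[of "V j" _ "V (j - 1)"]) (auto simp: color)
  next
    case (UV1 j)
    \<comment> \<open>The index \<open>j = last T\<close> would give the deleted edge; beyond it
      \<open>V j\<close> keeps color 1, the color of \<open>U 1\<close>.\<close>
    then have "second_last \<le> j" using second_le that(2) by auto
    then show ?thesis
      using UV1 last_less_second last_ge U_1_neq_V[of j]
      by (intro edge_two[of "U 1" _ "V j"]) (auto simp: color)
  qed
  have D: "\<exists>x\<in>e. \<exists>y\<in>e. extra_coloring x \<noteq> extra_coloring y" if "e \<in> D_edges T" for e
  proof -
    obtain x y where e: "e = {x, y}" and xy: "x \<in> X_verts T" "y \<in> X_verts T"
      and "\<And>i. i < length T \<Longrightarrow> x ! i \<noteq> y ! i"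
      using D_edgesE[OF \<open>e \<in> D_edges T\<close>] by blast
    then have ne: "x ! (length T - 1) \<noteq> y ! (length T - 1)" using T_nonempty by simp
    have V_last: "V j ! (length T - 1) = 1" if "last T \<le> j" for j
      using that T_nonempty by (simp add: V_nth last_T)
    have le: "z ! (length T - 1) \<le> last T" if "z \<in> X_verts T" for z
      using that V_last last_ge T_nonempty by (auto elim!: X_vertsE simp: U_nth last_T)
    \<comment> \<open>All recolored vertices share the last coordinate 1, so at most one of
      \<open>x\<close>, \<open>y\<close> is recolored, and the new color exceeds all old
      ones.\<close>
    have "extra_coloring x \<noteq> extra_coloring y"
      using ne le[OF xy(1)] le[OF xy(2)] V_last
      by (auto simp: extra_coloring_def split: if_splits)
    then show ?thesis using e by blast
  qed
  show ?thesis
    unfolding strict_coloring_def proper_coloring_def vertices_H c_edges_H d_edges_H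
    using sub sup C D by blast
qed

section \<open>Every strict coloring is a renamed model coloring\<close>

lemma coloring_factor:
  assumes "strict_coloring H k c"
  shows "(\<exists>i<length T. \<exists>g. inj_on g {1..T ! i} \<and> (\<forall>x\<in>X_verts T. c x = g (x ! i))) \<or>
    (\<exists>g. inj_on g {1..last T + 1} \<and> (\<forall>x\<in>X_verts T. c x = g (extra_coloring x)))"
proof -
  have C: "\<exists>x\<in>e. \<exists>y\<in>e. x \<noteq> y \<and> c x = c y"
    if "e \<in> C_star_edges T" "e \<noteq> {U (last T), V (last T), U 1}" for e
    using assms that by (simp add: strict_coloring_def proper_coloring_def c_edges_H)
  have D: "c x \<noteq> c y" if "{x, y} \<in> D_edges T" for x y
    using assms that unfolding strict_coloring_def proper_coloring_def d_edges_H by fastforce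
  have uu: "c (U j) \<noteq> c (U k)" if "1 \<le> j" "j < last T" "j < k" "k \<le> hd T" for j k
    using D D_edge_UU that by blast
  have vu: "c (V j) \<noteq> c (U k)"
    if "last T \<le> j" "j < hd T" "2 \<le> k" "k \<le> hd T" "k \<noteq> j" for j k
    using D D_edge_VU that by blast
  have c1: "c (U j) = c (V j) \<or> c (U j) = c (U (j + 1))" if j: "last T \<le> j" "j < hd T" for j
  proof -
    \<comment> \<open>The deleted triple contains \<open>U 1\<close>, so it suffices that
      \<open>U 1\<close> is not in the present one.\<close>
    have "U 1 \<noteq> V j" "U 1 \<noteq> U j" "U 1 \<noteq> U (j + 1)"
      using U_1_neq_V[OF j] inj_onD[OF inj_U, of 1 j] inj_onD[OF inj_U, of 1 "j + 1"] last_ge j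
      by auto
    then have "{V j, U j, U (j + 1)} \<noteq> {U (last T), V (last T), U 1}" by blast
    then show ?thesis
      using C[OF C_edge_VUU[OF j]] vu[of j "j + 1"] j last_ge by auto
  qed
  have c2: "c (U j) = c (V j) \<or> c (V j) = c (V (j - 1))"
    if j: "last T \<le> j" "j < hd T" "j \<notin> set T" for j
  proof -
    have "last T < j" using j T_nonempty by (metis last_in_set le_neq_implies_less)
    then have "U 1 \<noteq> V j" "U 1 \<noteq> U j" "U 1 \<noteq> V (j - 1)"
      using U_1_neq_V[of j] U_1_neq_V[of "j - 1"] inj_onD[OF inj_U, of 1 j] last_ge j
      by auto
    then have "{U j, V j, V (j - 1)} \<noteq> {U (last T), V (last T), U 1}" by blast
    moreover have "c (V (j - 1)) \<noteq> c (U j)"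
      using \<open>last T < j\<close> j last_ge by (intro vu) auto
    ultimately show ?thesis
      using C[OF C_edge_UVV[OF j]] by auto
  qed
  have c3: "c (U j) = c (V j) \<or> c (V j) = c (U 1)"
    if j: "last T < j" "j < hd T" "j \<in> set T" for j
  proof -
    \<comment> \<open>This triple does contain \<open>U 1\<close>; it is told apart from the deleted
      one by \<open>U j\<close>.\<close>
    have "U j \<noteq> U (last T)" "U j \<noteq> V (last T)" "U j \<noteq> U 1"
      using U_neq_V[of "last T" j] inj_onD[OF inj_U, of j "last T"] inj_onD[OF inj_U, of j 1]
        last_ge j by auto
    then have "{U j, V j, U 1} \<noteq> {U (last T), V (last T), U 1}" by blast
    then show ?thesis
      using C[OF C_edge_UV1[OF j(3,2)]] uu[of 1 j] j last_ge by auto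
  qed
  have m: "last T \<in> set T" "hd T \<in> set T" using T_nonempty by auto
  show ?thesis
  proof (rule threshold_coloring[where cu = "\<lambda>j. c (U j)" and cv = "\<lambda>j. c (V j)",
        OF last_ge last_less_second le_hd[OF second_in] m second_le second_in uu vu c1 c2 c3])
    fix p
    assume p: "p \<in> set T" and inj: "inj_on (\<lambda>j. c (U j)) {1..p}"
      and u: "\<And>j. \<lbrakk>1 \<le> j; j \<le> hd T\<rbrakk> \<Longrightarrow> c (U j) = c (U (min j p))"
      and v: "\<And>j. \<lbrakk>last T \<le> j; j < hd T\<rbrakk> \<Longrightarrow> c (V j) = c (U (if j < p then j else 1))"
    obtain i where i: "i < length T" "T ! i = p" using p by (auto simp: in_set_conv_nth)
    \<comment> \<open>The renaming is \<open>\<lambda>k. c (U k)\<close>: the vertex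
      \<open>U k\<close> represents color \<open>k\<close> of the coordinate coloring.\<close>
    have "\<forall>x\<in>X_verts T. c x = c (U (x ! i))"
      using i u v by (auto elim!: X_vertsE simp: U_nth V_nth)
    then show ?thesis using i inj by blast
  next
    assume inj: "inj_on (\<lambda>j. c (U j)) {1..last T}"
      and new: "c (V (last T)) \<notin> (\<lambda>j. c (U j)) ` {1..last T}"
      and u: "\<And>j. \<lbrakk>1 \<le> j; j \<le> hd T\<rbrakk> \<Longrightarrow> c (U j) = c (U (min j (last T)))"
      and v: "\<And>j. \<lbrakk>last T \<le> j; j < hd T\<rbrakk> \<Longrightarrow>
        c (V j) = (if j < second_last then c (V (last T)) else c (U 1))"
    define g where "g k = (if k = last T + 1 then c (V (last T)) else c (U k))" for k
    have "inj_on g {1..last T} \<longleftrightarrow> inj_on (\<lambda>j. c (U j)) {1..last T}"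
      by (intro inj_on_cong) (simp add: g_def)
    moreover have "g ` {1..last T} = (\<lambda>j. c (U j)) ` {1..last T}"
      by (intro image_cong) (simp_all add: g_def)
    moreover have "g (last T + 1) = c (V (last T))"
      by (simp add: g_def)
    moreover have "{1..last T + 1} = insert (last T + 1) {1..last T}"
      by auto
    ultimately have "inj_on g {1..last T + 1}"
      using inj new by simp
    moreover have "c x = g (extra_coloring x)" if "x \<in> X_verts T" for x
      using that
    proof (cases rule: X_vertsE)
      case (1 j)
      then show ?thesis using u[of j] by (simp add: g_def extra_coloring_U min_def)
    next
      case (2 j)
      then show ?thesis using v[of j] last_ge by (simp add: g_def extra_coloring_V)
    qed
    ultimately show ?thesis by blast
  qed
qed

lemma one_realization_H:
  assumes "last T + 1 \<notin> set T"
  shows "one_realization H (insert (last T + 1) (set T))"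
proof (rule one_realizationI)
  \<comment> \<open>The model colorings have to be indexed by their numbers of colors. Entries are
    distinct, so an entry determines its coordinate, and \<open>last T + 1\<close> is free for the
    extra coloring by assumption.\<close>
  define index where "index p = (SOME i. i < length T \<and> T ! i = p)" for p
  have index: "index p < length T \<and> T ! index p = p" if "p \<in> set T" for p
    unfolding index_def using that
    by (intro someI_ex[of "\<lambda>i. i < length T \<and> T ! i = p"]) (auto simp: in_set_conv_nth)
  have index_nth: "index (T ! i) = i" if "i < length T" for i
  proof -
    have "distinct T" using decreasing
      by (auto simp: distinct_conv_nth neq_iff dest: T_nth_less)
    then show ?thesis using index[of "T ! i"] that nth_eq_iff_index_eq by fastforce
  qed
  define d where "d p x = (if p = last T + 1 then extra_coloring x else x ! index p)" for p x
  have d_nth: "d (T ! i) = (\<lambda>x. x ! i)" if "i < length T" for i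
  proof
    have "T ! i \<noteq> last T + 1" using assms nth_mem[OF that] by metis
    then show "d (T ! i) x = x ! i" for x
      using that by (simp add: d_def index_nth)
  qed
  have d_extra: "d (last T + 1) = extra_coloring"
    by (simp add: d_def fun_eq_iff)
  show "is_mixed_hypergraph H" by (rule is_mixed_hypergraph_H)
  show "strict_coloring H p (d p)" if "p \<in> insert (last T + 1) (set T)" for p
    using that d_nth d_extra strict_coloring_nth strict_coloring_extra
    by (auto simp: in_set_conv_nth)
  show "\<exists>p\<in>insert (last T + 1) (set T). \<exists>g. inj_on g {1..p} \<and> (\<forall>x\<in>vertices H. c x = g (d p x))"
    if "strict_coloring H k c" for k c
    using coloring_factor[OF that]
  proof
    assume "\<exists>i<length T. \<exists>g. inj_on g {1..T ! i} \<and> (\<forall>x\<in>X_verts T. c x = g (x ! i))"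
    then obtain i g where "i < length T" "inj_on g {1..T ! i}" "\<forall>x\<in>X_verts T. c x = g (x ! i)"
      by blast
    then show ?thesis
      using d_nth[of i] unfolding vertices_H by (intro bexI[of _ "T ! i"] exI[of _ g]) auto
  next
    assume "\<exists>g. inj_on g {1..last T + 1} \<and> (\<forall>x\<in>X_verts T. c x = g (extra_coloring x))"
    then show ?thesis
      using d_extra unfolding vertices_H by (intro bexI[of _ "last T + 1"]) auto
  qed
qed

end

section \<open>From the family \<open>n\<close> to the tuple \<open>T\<close>\<close>

theorem theorem3p6:
  fixes n :: "nat \<Rightarrow> nat" and s :: nat and S :: "nat set"
  assumes "S = n ` {1..s}"
    and "\<And>i j. 1 \<le> i \<Longrightarrow> i < j \<Longrightarrow> j \<le> s \<Longrightarrow> n j < n i"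
    and "2 \<le> n s"
    and "n 1 - 1 \<notin> S"
    and "n s + 1 \<in> S"
  shows "one_realization (H_star1 n s) S"
proof -
  obtain q where q: "1 \<le> q" "q \<le> s" "n q = n s + 1"
    using assms(1,5) by auto
  have "q \<noteq> s" using q by auto
  \<comment> \<open>Two strict descents from \<open>q\<close> to \<open>s\<close> would make
    \<open>n q\<close> at least \<open>n s + 2\<close>.\<close>
  have "\<not> q < s - 1"
    using assms(2)[of q "s - 1"] assms(2)[of "s - 1" s] q by auto
  then have q_eq: "q = s - 1" using q \<open>q \<noteq> s\<close> by simp
  have s: "3 \<le> s"
  proof (rule ccontr)
    assume "\<not> 3 \<le> s"
    then have "q = 1" using q q_eq by auto
    \<comment> \<open>For \<open>s = 2\<close> the number \<open>n 1 - 1\<close> would be the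
      smallest element of \<open>S\<close>, against the hypothesis.\<close>
    then have "n 1 - 1 = n s" using q by simp
    then show False using assms(1,4) q by auto
  qed
  define T where "T = T_of n s"
  have len: "length T = s - 1" and last: "last T = n s"
    using s by (simp_all add: T_def T_of_def)
  have "sorted_wrt (\<lambda>i j. n i > n j) [1..<s - 1]"
    using assms(2) by (auto simp: sorted_wrt_iff_nth_less)
  then have "sorted_wrt (>) T"
    using assms(2) by (auto simp: T_def T_of_def sorted_wrt_append sorted_wrt_map)
  then interpret decreasing_tuple T
    using s len last assms(3) by unfold_locales auto
  have set_T: "set T = n ` ({1..s} - {s - 1})"
  proof -
    have "set T = n ` ({1..<s - 1} \<union> {s})" by (auto simp: T_def T_of_def)
    also have "{1..<s - 1} \<union> {s} = {1..s} - {s - 1}" using s by auto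
    finally show ?thesis .
  qed
  have inj: "inj_on n {1..s}"
    using assms(2) by (intro linorder_inj_onI) (auto simp: neq_iff)
  have "last T + 1 \<notin> set T"
    using inj_on_image_mem_iff[OF inj, of "s - 1" "{1..s} - {s - 1}"] q q_eq
    by (auto simp: set_T last)
  moreover have "insert (last T + 1) (set T) = S"
  proof -
    have "last T + 1 = n (s - 1)" using q q_eq by (simp add: last)
    then have "insert (last T + 1) (set T) = n ` insert (s - 1) ({1..s} - {s - 1})"
      by (simp only: set_T image_insert)
    also have "insert (s - 1) ({1..s} - {s - 1}) = {1..s}" using s by auto
    finally show ?thesis by (simp only: assms(1))
  qed
  moreover have "H = H_star1 n s"
  proof -
    \<comment> \<open>Instance \<open>t = length T\<close>, \<open>j = last T\<close> of
      \<open>v_vertex_eq\<close>, that is \<open>v_(s-1)(n_s)\<close>; the other two vertices of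
      \<open>e_2\<close> are constant tuples.\<close>
    have "V (last T) = replicate (s - 2) (n s) @ [1]"
      using v_vertex_eq[of "length T" "last T"] ent_last ent_less[of "length T"] len last s
      by (simp add: v_vertex_def numeral_2_eq_2 Suc_diff_Suc)
    moreover have "U (last T) = replicate (s - 1) (n s)" "U 1 = replicate (s - 1) 1"
      using replicate_eq_U[of "last T"] replicate_eq_U[of 1] len last assms(3) by simp_all
    ultimately show ?thesis
      by (simp add: H_def H_star1_def e2_of_def insert_commute flip: T_def)
  qed
  ultimately show ?thesis using one_realization_H by simp
qed

end
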